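(* Let $\xi:\mathbb{N}\to[1,\infty)$ be non-decreasing and unbounded, and set $\psi_\xi(n)=\frac{1}{n(\log n)^2\xi(n)}$. Then there are continuum many pairs $(\alpha_1,\gamma_1)$ with $\alpha_1$ a Liouville number and $\gamma_1\in\mathbb{R}$ such that for every $\gamma_2\in\mathbb{R}$ and almost all $\alpha_2\in\mathbb{R}$ the inequality \[\|n\alpha_1-\gamma_1\|\cdot\|n\alpha_2-\gamma_2\|<\psi_\xi(n)\] has at most finitely many solutions $n\in\mathbb{N}$.
   Context: $\|x\|$ denotes the distance from $x$ to the nearest integer. A Liouville number is an irrational $\alpha$ such that for every $w>0$, $\|n\alpha\|<n^{-w}$ for infinitely many $n\in\mathbb{N}$. Here $\log x=\max(\ln x,1)$. "Almost all" refers to Lebesgue measure. *)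

theory Defs
  imports "HOL-Analysis.Analysis" "HOL-Library.Equipollence"
begin

definition dist_nearest_int :: "real \<Rightarrow> real" where
  "dist_nearest_int x = \<bar>x - of_int (round x)\<bar>"

(* The natural numbers start at 1 throughout: 0 is not an admissible n. *)

definition liouville :: "real \<Rightarrow> bool" where
  "liouville \<alpha> \<longleftrightarrow> \<alpha> \<notin> \<rat> \<and>
     (\<forall>w::real. w > 0 \<longrightarrow>
        infinite {n::nat. n \<ge> 1 \<and> dist_nearest_int (real n * \<alpha>) < real n powr (- w)})"

definition log1 :: "real \<Rightarrow> real" where
  "log1 x = max (ln x) 1"

definition psi :: "(nat \<Rightarrow> real) \<Rightarrow> nat \<Rightarrow> real" where
  "psi \<xi> n = 1 / (real n * (log1 (real n))\<^sup>2 * \<xi> n)"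

end

theory Submission
  imports Defs
begin

text \<open>Take \<alpha> to be the sum of c_i / 2^(a_i) with free digits c_i in {1, 3} and a rapidly growing
  sequence a_i, and put \<gamma> = \<alpha> / 2. By Borel--Cantelli it suffices that
  psi n / ||n \<alpha> - \<gamma>|| is summable. Here n \<alpha> - \<gamma> = (2n-1) \<alpha> / 2, and the k-th partial sum of the
  series is P / h with P odd and h = 2^(a_k). For n up to about 2^(a_{k+1}) / h the tail of the series
  only perturbs (2n-1) P / (2h) by a quarter of 1 / h, while (2n-1) P / (2h) is at distance at least
  1 / (2h) from the integers. Hence h consecutive values of 1 / ||n \<alpha> - \<gamma>|| sum to O(h ln h), and
  summation over blocks starting at h costs only
  O(ln h / \<xi> h) times the sum of 1 / (m ln(mh)^2), which is O(1 / \<xi> h). The remaining range up to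
  2^(a_{k+1}) is a single block of the next level, and it contributes O(2^(a_k) / a_{k+1}). Both bounds
  are at most a constant times 2^(-k) if the a_k grow fast enough. Different digit sequences give different \<alpha>.\<close>

section \<open>Elementary properties of the distance to the nearest integer\<close>

lemma dist_nearest_int_nonneg [simp]: "0 \<le> dist_nearest_int x"
  by (simp add: dist_nearest_int_def)

lemma dist_nearest_int_le: "dist_nearest_int x \<le> \<bar>x - of_int m\<bar>"
  unfolding dist_nearest_int_def using round_diff_minimal[of x m] by (simp add: abs_minus_commute)

lemma dist_nearest_int_geI:
  assumes "\<And>m::int. c \<le> \<bar>x - of_int m\<bar>"
  shows "c \<le> dist_nearest_int x"
  using assms by (simp add: dist_nearest_int_def)

text \<open>One half of the fact that the distance to the nearest integer is 1-Lipschitz.\<close>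

lemma dist_nearest_int_perturb: "dist_nearest_int x - \<bar>y\<bar> \<le> dist_nearest_int (x + y)"
proof (rule dist_nearest_int_geI)
  fix m :: int
  show "dist_nearest_int x - \<bar>y\<bar> \<le> \<bar>x + y - of_int m\<bar>"
    using dist_nearest_int_le[of x m] by linarith
qed

lemma dist_nearest_int_add_of_int: "dist_nearest_int (x + of_int k) = dist_nearest_int x"
proof (rule antisym)
  show "dist_nearest_int (x + of_int k) \<le> dist_nearest_int x"
    using dist_nearest_int_le[of "x + of_int k" "round x + k"] by (simp add: dist_nearest_int_def)
  show "dist_nearest_int x \<le> dist_nearest_int (x + of_int k)"
    using dist_nearest_int_le[of x "round (x + of_int k) - k"]
    by (simp add: dist_nearest_int_def algebra_simps)
qed

lemma dist_nearest_int_pos_iff: "0 < dist_nearest_int x \<longleftrightarrow> x \<notin> \<int>"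
proof
  show "x \<notin> \<int>" if "0 < dist_nearest_int x"
    using that dist_nearest_int_le[of x] by (metis Ints_cases abs_zero diff_self leD)
  show "0 < dist_nearest_int x" if "x \<notin> \<int>"
    using that unfolding dist_nearest_int_def
    by (metis Ints_of_int eq_iff_diff_eq_0 zero_less_abs_iff)
qed

section \<open>The convergence half of Borel--Cantelli for inhomogeneous approximation\<close>

text \<open>Borel--Cantelli: inside [-M, M] the n-th inequality defines a set covered by O(n) intervals
  of length 2 \<delta> n / n.\<close>
lemma AE_finite_dist_nearest_int_less:
  fixes \<delta> :: "nat \<Rightarrow> real" and \<gamma> :: real
  assumes sm: "summable \<delta>" and nonneg: "\<And>n. 0 \<le> \<delta> n"
  shows "AE x in lebesgue. finite {n. n \<ge> 1 \<and> dist_nearest_int (real n * x - \<gamma>) < \<delta> n}"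
proof -
  have AE_M: "AE x in lborel. \<bar>x\<bar> \<le> real M \<longrightarrow>
      finite {n. n \<ge> 1 \<and> dist_nearest_int (real n * x - \<gamma>) < \<delta> n}" for M :: nat
  proof -
    \<comment> \<open>For \<open>\<bar>x\<bar> \<le> M\<close> the integer nearest to
      \<open>n * x - \<gamma>\<close> has absolute value at most \<open>L n\<close>, so finitely
      many centres per \<open>n\<close> suffice.\<close>
    define L where "L n = \<lceil>real n * M + \<bar>\<gamma>\<bar> + 1\<rceil>" for n
    define I where "I n = {- L n..L n}" for n
    define B where "B n p = cball ((\<gamma> + of_int p) / real n) (\<delta> n / real n)" for n and p :: int
    define E where "E n = (if n = 0 then {} else \<Union>p\<in>I n. B n p)" for n
    have L_nonneg: "0 \<le> L n" for n
      unfolding L_def by (simp add: add_nonneg_nonneg less_le_trans[of "-1" 0])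
    have sets: "E n \<in> sets lborel" for n
      unfolding E_def B_def I_def by auto
    have fmeas: "B n p \<in> fmeasurable lborel" for n p
      unfolding B_def by (intro fmeasurableI emeasure_lborel_cball_finite) simp
    have fmeasE: "E n \<in> fmeasurable lborel" for n
      using fmeas unfolding E_def I_def by (auto intro!: fmeasurable.finite_UN)
    have meas: "measure lborel (E n) \<le> (2 * real M + 2 * \<bar>\<gamma>\<bar> + 5) * 2 * \<delta> n" for n
    proof (cases "n = 0")
      case True
      then show ?thesis using nonneg by (simp add: E_def)
    next
      case False
      have "measure lborel (E n) \<le> (\<Sum>p\<in>I n. measure lborel (B n p))"
        using False fmeas unfolding E_def I_def by (auto intro!: measure_UNION_le)
      also have "\<dots> = (\<Sum>p\<in>I n. 2 * \<delta> n / real n)"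
      proof (rule sum.cong)
        fix p
        show "measure lborel (B n p) = 2 * \<delta> n / real n"
          using nonneg[of n] False by (simp add: B_def cball_eq_atLeastAtMost)
      qed simp
      also have "\<dots> = real_of_int (2 * L n + 1) * (2 * \<delta> n / real n)"
        using L_nonneg[of n] by (simp add: I_def)
      \<comment> \<open>Since \<open>n \<ge> 1\<close>, the number of centres is at most a constant
        times \<open>n\<close>, which cancels the \<open>n\<close> in the radius.\<close>
      also have "\<dots> \<le> (real n * (2 * real M + 2 * \<bar>\<gamma>\<bar> + 5)) * (2 * \<delta> n / real n)"
      proof (rule mult_right_mono)
        have "real_of_int (L n) \<le> real n * M + \<bar>\<gamma>\<bar> + 2"
          unfolding L_def by linarith
        moreover have "\<bar>\<gamma>\<bar> \<le> real n * \<bar>\<gamma>\<bar>"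
          using False by (simp add: mult_le_cancel_right1)
        moreover have "1 \<le> real n" using False by simp
        ultimately show "real_of_int (2 * L n + 1) \<le> real n * (2 * real M + 2 * \<bar>\<gamma>\<bar> + 5)"
          by (simp add: algebra_simps)
      qed (use nonneg in simp)
      also have "\<dots> = (2 * real M + 2 * \<bar>\<gamma>\<bar> + 5) * 2 * \<delta> n"
        using False by simp
      finally show ?thesis .
    qed
    have "summable (\<lambda>n. measure lborel (E n))"
      by (rule summable_comparison_test'[OF summable_mult[OF sm], of 0])
         (use meas in \<open>simp\<close>)
    then have "AE x in lborel. eventually (\<lambda>n. x \<in> space lborel - E n) sequentially"
      using fmeasurableD2[OF fmeasE] by (intro borel_cantelli_AE1 sets) (auto simp: less_top)
    then show ?thesis
    proof (rule AE_mp, intro AE_I2 impI)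
      fix x :: real
      assume ev: "eventually (\<lambda>n. x \<in> space lborel - E n) sequentially" and x: "\<bar>x\<bar> \<le> real M"
      have "x \<in> E n" if n: "n \<ge> 1" "dist_nearest_int (real n * x - \<gamma>) < \<delta> n" for n
      proof -
        define p where "p = round (real n * x - \<gamma>)"
        have less: "\<bar>real n * x - \<gamma> - of_int p\<bar> < \<delta> n"
          using n(2) by (simp add: dist_nearest_int_def p_def)
        have "\<bar>real n * x\<bar> \<le> real n * M"
          using x by (simp add: abs_mult mult_left_mono)
        then have "\<bar>of_int p\<bar> \<le> real n * M + \<bar>\<gamma>\<bar> + 1"
          using of_int_round_abs_le[of "real n * x - \<gamma>"] unfolding p_def by linarith
        then have "p \<in> I n"
          unfolding I_def L_def atLeastAtMost_iff by linarith
        moreover have "\<bar>x - (\<gamma> + of_int p) / real n\<bar> = \<bar>real n * x - \<gamma> - of_int p\<bar> / real n"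
        proof -
          have "x - (\<gamma> + of_int p) / real n = (real n * x - \<gamma> - of_int p) / real n"
            using n(1) by (simp add: field_simps)
          then show ?thesis by (simp add: abs_divide)
        qed
        then have "x \<in> B n p"
          using less n(1) by (simp add: B_def dist_real_def abs_minus_commute divide_right_mono)
        ultimately show ?thesis using n(1) by (auto simp: E_def)
      qed
      moreover obtain N where "\<And>n. n \<ge> N \<Longrightarrow> x \<notin> E n"
        using ev by (auto simp: eventually_sequentially)
      ultimately have "{n. n \<ge> 1 \<and> dist_nearest_int (real n * x - \<gamma>) < \<delta> n} \<subseteq> {..<N}"
        by (metis (mono_tags, lifting) lessThan_iff linorder_not_less mem_Collect_eq subsetI)
      then show "finite {n. n \<ge> 1 \<and> dist_nearest_int (real n * x - \<gamma>) < \<delta> n}"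
        using finite_subset by blast
    qed
  qed
  \<comment> \<open>Countably many null sets, one per \<open>M\<close>, exhaust the line.\<close>
  have "AE x in lborel. \<forall>M::nat. \<bar>x\<bar> \<le> real M \<longrightarrow>
      finite {n. n \<ge> 1 \<and> dist_nearest_int (real n * x - \<gamma>) < \<delta> n}"
    unfolding AE_all_countable using AE_M by blast
  then have "AE x in lborel. finite {n. n \<ge> 1 \<and> dist_nearest_int (real n * x - \<gamma>) < \<delta> n}"
    by (rule AE_mp, intro AE_I2 impI) (metis real_arch_simple)
  then show ?thesis by (rule AE_completion)
qed

section \<open>Sums of reciprocal distances and of the logarithmic series\<close>

text \<open>The map sending n to (2n-1)P mod 2h is injective on h consecutive integers and, its values
  being odd, avoids 0; so the sum is bounded by the one over all nonzero residues.\<close>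
lemma sum_inverse_dist_le:
  fixes P :: int and h s :: nat
  assumes h: "h \<ge> 1" and cop: "coprime P (2 * int h)"
  shows "(\<Sum>n = s..<s + h. 1 / dist_nearest_int ((2 * real n - 1) * (of_int P / (2 * real h))))
           \<le> 4 * real h * harm (2 * h - 1)"
proof -
  define q where "q = 2 * h"
  define g :: "nat \<Rightarrow> real" where "g j = 1 / dist_nearest_int (real j / real q)" for j
  define \<phi> where "\<phi> n = nat ((2 * int n - 1) * P mod int q)" for n
  have q: "q \<ge> 2" using h by (simp add: q_def)
  have oddP: "odd P" using cop by (metis coprime_mult_right_iff coprime_right_2_iff_odd)
  have copP: "coprime P (int h)" using cop by (simp add: coprime_mult_right_iff)
  have int_phi: "int (\<phi> n) = (2 * int n - 1) * P mod int q" for n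
    using q by (simp add: \<phi>_def)
  have g_phi: "g (\<phi> n) = 1 / dist_nearest_int ((2 * real n - 1) * (of_int P / (2 * real h)))" for n
  proof -
    define t where "t = (2 * int n - 1) * P"
    have "t = int q * (t div int q) + t mod int q" by simp
    then have "real_of_int t = real q * of_int (t div int q) + real (\<phi> n)"
      using int_phi[of n] unfolding t_def[symmetric]
      by (metis of_int_add of_int_mult of_int_of_nat_eq)
    then have "real_of_int t / real q = real (\<phi> n) / real q + of_int (t div int q)"
      using q by (simp add: field_simps)
    moreover have "(2 * real n - 1) * (of_int P / (2 * real h)) = real_of_int t / real q"
      by (simp add: t_def q_def)
    ultimately show ?thesis
      unfolding g_def by (simp add: dist_nearest_int_add_of_int)
  qed
  have inj: "inj_on \<phi> {s..<s + h}"
  proof (rule inj_onI)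
    fix m n assume mn: "m \<in> {s..<s + h}" "n \<in> {s..<s + h}" and eq: "\<phi> m = \<phi> n"
    have "(2 * int m - 1) * P mod int q = (2 * int n - 1) * P mod int q"
      using eq int_phi by metis
    then have "int q dvd (2 * int m - 1) * P - (2 * int n - 1) * P"
      by (simp add: mod_eq_dvd_iff)
    \<comment> \<open>The step from \<open>n\<close> to \<open>n + 1\<close> adds
      \<open>2 * P\<close>, so the 2 in the modulus cancels and injectivity lasts for
      \<open>h\<close>, not \<open>2 * h\<close>, consecutive integers.\<close>
    then have "2 * int h dvd 2 * ((int m - int n) * P)"
      by (simp add: q_def algebra_simps)
    then have "int h dvd (int m - int n) * P" by simp
    then have dvd: "int h dvd int m - int n"
      using copP by (simp add: coprime_commute coprime_dvd_mult_left_iff)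
    have "\<bar>int m - int n\<bar> < int h" using mn by auto
    then show "m = n" using dvd zdvd_imp_le[of "int h" "\<bar>int m - int n\<bar>"] by force
  qed
  have img: "\<phi> ` {s..<s + h} \<subseteq> {1..q - 1}"
  proof safe
    fix n
    have "odd ((2 * int n - 1) * P)" using oddP by simp
    then have "odd (int (\<phi> n))"
      unfolding int_phi by (simp add: q_def dvd_mod_iff)
    then have "\<phi> n \<noteq> 0" by (metis even_zero of_nat_0)
    moreover have "int (\<phi> n) < int q" unfolding int_phi using q by simp
    ultimately show "\<phi> n \<in> {1..q - 1}" by auto
  qed
  \<comment> \<open>The distance of \<open>j / q\<close> from the integers is at least the minimum
    of \<open>j\<close> and \<open>q - j\<close>, divided by \<open>q\<close>; the reciprocal of a
    minimum is at most the sum of the reciprocals. By the reflection of \<open>j\<close> to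
    \<open>q - j\<close> both sums are equal.\<close>
  have gb: "g j \<le> real q * inverse (real j) + real q * inverse (real (q - j))" if j: "j \<in> {1..q - 1}" for j
  proof -
    define \<mu> where "\<mu> = min (real j) (real (q - j))"
    have mu: "\<mu> > 0" using j q by (auto simp: \<mu>_def)
    have "\<mu> / real q \<le> dist_nearest_int (real j / real q)"
    proof (rule dist_nearest_int_geI)
      fix m :: int
      have "\<mu> \<le> \<bar>real j - real q * of_int m\<bar>"
      proof (cases "m \<le> 0")
        case True
        then have "real q * of_int m \<le> 0" by (simp add: mult_nonneg_nonpos)
        then show ?thesis by (simp add: \<mu>_def)
      next
        case False
        then have "real q * 1 \<le> real q * of_int m" by (intro mult_left_mono) auto
        moreover have "real (q - j) = real q - real j" using j by auto
        ultimately show ?thesis by (simp add: \<mu>_def)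
      qed
      then have "\<mu> / real q \<le> \<bar>real j - real q * of_int m\<bar> / real q"
        by (simp add: divide_right_mono)
      also have "\<dots> = \<bar>(real j - real q * of_int m) / real q\<bar>" by simp
      also have "(real j - real q * of_int m) / real q = real j / real q - of_int m"
        using q by (simp add: field_simps)
      finally show "\<mu> / real q \<le> \<bar>real j / real q - of_int m\<bar>" .
    qed
    then have "g j \<le> 1 / (\<mu> / real q)"
      unfolding g_def using mu q by (intro divide_left_mono mult_pos_pos) (auto intro: less_le_trans[of _ "\<mu> / real q"])
    also have "\<dots> = real q * inverse \<mu>" by (simp add: divide_simps)
    also have "\<dots> \<le> real q * (inverse (real j) + inverse (real (q - j)))"
      by (intro mult_left_mono) (auto simp: \<mu>_def min_def)
    finally show ?thesis by (simp add: distrib_left)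
  qed
  have "(\<Sum>n = s..<s + h. 1 / dist_nearest_int ((2 * real n - 1) * (of_int P / (2 * real h))))
      = (\<Sum>n = s..<s + h. g (\<phi> n))" by (simp add: g_phi)
  also have "\<dots> = sum g (\<phi> ` {s..<s + h})" using inj by (simp add: sum.reindex)
  also have "\<dots> \<le> sum g {1..q - 1}"
    using img by (intro sum_mono2) (auto simp: g_def)
  also have "\<dots> \<le> (\<Sum>j = 1..q - 1. real q * inverse (real j) + real q * inverse (real (q - j)))"
    by (intro sum_mono gb)
  also have "\<dots> = real q * (\<Sum>j = 1..q - 1. inverse (real j)) + real q * (\<Sum>j = 1..q - 1. inverse (real (q - j)))"
    by (simp add: sum.distrib sum_distrib_left)
  also have "(\<Sum>j = 1..q - 1. inverse (real (q - j))) = (\<Sum>j = 1..q - 1. inverse (real j))"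
    by (rule sum.reindex_bij_witness[of _ "\<lambda>j. q - j" "\<lambda>j. q - j"]) auto
  finally show ?thesis by (simp add: harm_def q_def)
qed

text \<open>The difference of \<open>harm n\<close> and \<open>ln n\<close> decreases, and it equals
  1 at \<open>n = 1\<close>.\<close>

lemma harm_le_1_plus_ln:
  assumes "n \<ge> 1"
  shows "harm n \<le> 1 + ln (real n)"
proof -
  obtain m where m: "n = Suc m" using assms by (cases n) auto
  have "harm (Suc m) - ln (real (Suc m)) \<le> harm (Suc 0) - ln (real (Suc 0))"
    using decseqD[OF decseq_harm_diff_ln, of 0 m] by simp
  then show ?thesis by (simp add: m harm_expand)
qed

text \<open>Telescoping, since 1 / ln ((m-1)h) - 1 / ln (mh) is at least 1 / (m ln (mh)^2).\<close>
lemma sum_inverse_mult_ln_square_le: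
  fixes h :: real
  assumes "h > 1" "M \<ge> 1"
  shows "(\<Sum>m = 1..M. 1 / (real m * (ln (real m * h))\<^sup>2)) \<le> 1 / (ln h)\<^sup>2 + 1 / ln h - 1 / ln (real M * h)"
  using assms(2)
proof (induction M rule: dec_induct)
  \<comment> \<open>The first term is the summand \<open>1 / (ln h)\<^sup>2\<close> of the bound;
    all later terms telescope.\<close>
  case base
  then show ?case by simp
next
  case (step m)
  define u v where "u = ln (real m * h)" and "v = ln (real (Suc m) * h)"
  have m: "real m \<ge> 1" using step by simp
  have "1 * h \<le> real m * h" using m assms(1) by (intro mult_right_mono) auto
  then have "1 < real m * h" using assms(1) by linarith
  then have u: "u > 0" by (simp add: u_def)
  have uv: "v = u + ln (real (Suc m) / real m)"
    using m assms(1) by (simp add: u_def v_def ln_mult ln_div del: of_nat_Suc)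
  \<comment> \<open>This is \<open>ln x \<le> x - 1\<close> at
    \<open>x = m / (m + 1)\<close>.\<close>
  have "1 / real (Suc m) \<le> ln (real (Suc m) / real m)"
  proof -
    have "ln (real m / real (Suc m)) \<le> real m / real (Suc m) - 1"
      using m by (intro ln_le_minus_one) auto
    moreover have "ln (real m / real (Suc m)) = - ln (real (Suc m) / real m)"
      using m by (simp add: ln_div)
    moreover have "real m / real (Suc m) - 1 = - (1 / real (Suc m))"
      by (simp add: field_simps)
    ultimately show ?thesis by linarith
  qed
  then have diff: "1 / real (Suc m) \<le> v - u" using uv by simp
  have "0 < 1 / real (Suc m)" by simp
  then have "u \<le> v" using diff by linarith
  have "1 / (real (Suc m) * v\<^sup>2) = (1 / real (Suc m)) / v\<^sup>2" by simp
  also have "\<dots> \<le> (v - u) / v\<^sup>2" using diff by (intro divide_right_mono) auto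
  also have "\<dots> \<le> (v - u) / (u * v)"
    using u \<open>u \<le> v\<close> by (intro divide_left_mono) (auto simp: power2_eq_square mult_right_mono)
  also have "\<dots> = 1 / u - 1 / v" using u \<open>u \<le> v\<close> by (simp add: field_simps)
  finally have "1 / (real (Suc m) * v\<^sup>2) \<le> 1 / u - 1 / v" .
  then show ?case using step by (simp add: u_def v_def del: of_nat_Suc)
qed

section \<open>Summing \<open>psi\<close> against reciprocal distances block by block\<close>

lemma psi_nonneg: "(\<And>n. n \<ge> 1 \<Longrightarrow> \<xi> n \<ge> 1) \<Longrightarrow> 0 \<le> psi \<xi> n"
  unfolding psi_def by (cases "n = 0") (auto intro!: divide_nonneg_nonneg mult_nonneg_nonneg simp: order_trans[of 0 1])

lemma psi_le:
  assumes "2 \<le> N" "N \<le> n" "0 < X" "X \<le> \<xi> n"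
  shows "psi \<xi> n \<le> 1 / (real N * (ln (real N))\<^sup>2 * X)"
proof -
  have pos: "0 < ln (real N)" using assms by simp
  have "ln (real N) \<le> log1 (real n)" using assms by (simp add: log1_def le_max_iff_disj)
  then have "(ln (real N))\<^sup>2 \<le> (log1 (real n))\<^sup>2" using pos by (intro power_mono) auto
  then have "real N * (ln (real N))\<^sup>2 * X \<le> real n * (log1 (real n))\<^sup>2 * \<xi> n"
    using assms by (intro mult_mono) auto
  moreover have "0 < real N * (ln (real N))\<^sup>2 * X" using assms pos by simp
  ultimately show ?thesis unfolding psi_def by (intro frac_le) auto
qed

text \<open>The block \<open>m = 0\<close> is left out: the integers below \<open>h\<close> are
  treated at the preceding level.\<close>

lemma sum_consecutive_blocks:
  fixes f :: "nat \<Rightarrow> 'a::comm_monoid_add"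
  assumes "1 \<le> M"
  shows "sum f {h..<M * h} = (\<Sum>m = 1..<M. sum f {m * h..<m * h + h})"
  using assms
proof (induction M rule: dec_induct)
  case (step M)
  have "sum f {h..<Suc M * h} = sum f {h..<M * h} + sum f {M * h..<M * h + h}"
    using step by (subst sum.atLeastLessThan_concat) (auto simp: add.commute)
  then show ?case using step by simp
qed simp

text \<open>\<open>D\<close> stands for the distances. On block \<open>m\<close>, \<open>psi\<close>
  is at most \<open>1 / (m * h * (ln (m * h))\<^sup>2 * X)\<close>; against the block sum the
  \<open>h\<close> cancels, and the remaining series over \<open>m\<close> is at most
  \<open>2 / ln h\<close>, which cancels the factor \<open>ln h\<close>.\<close>

lemma sum_psi_blocks_le:
  fixes D :: "nat \<Rightarrow> real"
  assumes h: "3 \<le> h" and M: "1 \<le> M" and X: "0 < X" "\<And>n. h \<le> n \<Longrightarrow> X \<le> \<xi> n"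
    and D: "\<And>n. 0 \<le> D n" and C: "0 \<le> C"
    and block: "\<And>m. 1 \<le> m \<Longrightarrow> m < M \<Longrightarrow> (\<Sum>n = m * h..<m * h + h. 1 / D n) \<le> C * real h * ln (real h)"
  shows "(\<Sum>n = h..<M * h. psi \<xi> n / D n) \<le> 2 * C / X"
proof (cases "M = 1")
  case True
  then show ?thesis using C X by simp
next
  case False
  then have M2: "1 \<le> M - 1" using M by simp
  define l where "l = ln (real h)"
  \<comment> \<open>This is where \<open>3 \<le> h\<close> enters: \<open>ln h \<ge> 1\<close> lets
    \<open>1 / l\<close> absorb \<open>1 / l\<^sup>2\<close>, whence the 2 in the result.\<close>
  have "exp 1 \<le> real h" using exp_le h by linarith
  then have l: "1 \<le> l" unfolding l_def using h by (simp add: ln_ge_iff)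
  have block': "(\<Sum>n = m * h..<m * h + h. psi \<xi> n / D n)
      \<le> C * l / X * (1 / (real m * (ln (real m * real h))\<^sup>2))" if m: "m \<in> {1..<M}" for m
  proof -
    have "h \<le> m * h" using m by simp
    define B where "B = 1 / (real (m * h) * (ln (real (m * h)))\<^sup>2 * X)"
    have "B \<ge> 0" unfolding B_def using X by simp
    have "psi \<xi> n / D n \<le> B * (1 / D n)" if "m * h \<le> n" for n
    proof -
      have "psi \<xi> n \<le> B"
        unfolding B_def
      proof (rule psi_le)
        show "2 \<le> m * h" using \<open>h \<le> m * h\<close> h by linarith
        show "X \<le> \<xi> n" using X(2) order_trans[OF \<open>h \<le> m * h\<close> that] by blast
      qed (use that X in auto)
      then show ?thesis using D[of n] by (simp add: divide_right_mono)
    qed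
    then have "(\<Sum>n = m * h..<m * h + h. psi \<xi> n / D n) \<le> B * (\<Sum>n = m * h..<m * h + h. 1 / D n)"
      unfolding sum_distrib_left by (intro sum_mono) auto
    also have "\<dots> \<le> B * (C * real h * l)"
      using block m \<open>B \<ge> 0\<close> unfolding l_def by (intro mult_left_mono) auto
    also have "\<dots> = C * l / X * (1 / (real m * (ln (real m * real h))\<^sup>2))"
      using h unfolding B_def by simp
    finally show ?thesis .
  qed
  have "(\<Sum>n = h..<M * h. psi \<xi> n / D n) = (\<Sum>m = 1..<M. \<Sum>n = m * h..<m * h + h. psi \<xi> n / D n)"
    by (rule sum_consecutive_blocks[OF M])
  also have "\<dots> \<le> (\<Sum>m = 1..<M. C * l / X * (1 / (real m * (ln (real m * real h))\<^sup>2)))"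
    by (intro sum_mono block')
  also have "\<dots> = C * l / X * (\<Sum>m = 1..M - 1. 1 / (real m * (ln (real m * real h))\<^sup>2))"
  proof -
    have "{1..<M} = {1..M - 1}" using M by auto
    then show ?thesis by (simp only: sum_distrib_left)
  qed
  also have "\<dots> \<le> C * l / X * (2 / l)"
  proof (rule mult_left_mono)
    have "(\<Sum>m = 1..M - 1. 1 / (real m * (ln (real m * real h))\<^sup>2)) \<le> 1 / l\<^sup>2 + 1 / l - 1 / ln (real (M - 1) * real h)"
      unfolding l_def using M2 h by (intro sum_inverse_mult_ln_square_le) auto
    moreover have "1 / l\<^sup>2 \<le> 1 / l" using l by (simp add: divide_simps power2_eq_square)
    moreover have "1 * 1 \<le> real (M - 1) * real h" using M2 h by (intro mult_mono) auto
    then have "0 \<le> ln (real (M - 1) * real h)" by (intro ln_ge_zero) linarith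
    then have "0 \<le> 1 / ln (real (M - 1) * real h)" by (rule divide_nonneg_nonneg[OF zero_le_one])
    ultimately show "(\<Sum>m = 1..M - 1. 1 / (real m * (ln (real m * real h))\<^sup>2)) \<le> 2 / l" by linarith
  qed (use C X l in auto)
  also have "\<dots> = 2 * C / X" using l by simp
  finally show ?thesis .
qed

section \<open>A family of Liouville numbers indexed by sets of naturals\<close>

text \<open>\<open>a_quad\<close> makes \<open>a (Suc k)\<close> outgrow every fixed multiple of
  \<open>a k\<close>, which gives the Liouville property; \<open>a_exp\<close> makes
  \<open>2 ^ a k / a (Suc k)\<close> at most \<open>1 / 2 ^ a k\<close>, which pays for the range
  just below \<open>2 ^ a (Suc k)\<close>.\<close>

locale sparse_exponents =
  fixes a :: "nat \<Rightarrow> nat"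
  assumes a_0: "10 \<le> a 0"
    and a_exp: "4 ^ a k \<le> a (Suc k)"
    and a_quad: "(a k)\<^sup>2 + 4 * a k + 10 \<le> a (Suc k)"
begin

text \<open>Both digits are odd, so every partial sum has an odd numerator; encoding the choices by
  a set gives continuum many sequences.\<close>

definition digit :: "nat set \<Rightarrow> nat \<Rightarrow> int" where
  "digit A i = (if i \<in> A then 3 else 1)"

definition alpha :: "nat set \<Rightarrow> real" where
  "alpha A = (\<Sum>i. of_int (digit A i) / 2 ^ a i)"

text \<open>The numerator of the \<open>k\<close>-th partial sum of \<open>alpha A\<close> over the
  denominator \<open>2 ^ a k\<close>.\<close>

definition num :: "nat set \<Rightarrow> nat \<Rightarrow> int" where
  "num A k = (\<Sum>i\<le>k. digit A i * 2 ^ (a k - a i))"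

lemma a_add: "a k + j \<le> a (k + j)"
proof (induction j)
  case (Suc j)
  then show ?case using a_quad[of "k + j"] by simp
qed simp

lemma a_mono: "i \<le> j \<Longrightarrow> a i \<le> a j"
  using a_add[of i "j - i"] by simp

lemma a_ge: "k + 10 \<le> a k"
  using a_add[of 0 k] a_0 by simp

lemma num_div: "of_int (num A k) / 2 ^ a k = (\<Sum>i\<le>k. of_int (digit A i) / (2 ^ a i :: real))"
proof -
  have "of_int (num A k) / 2 ^ a k = (\<Sum>i\<le>k. of_int (digit A i) * 2 ^ (a k - a i) / (2 ^ a k :: real))"
    by (simp add: num_def sum_divide_distrib)
  also have "\<dots> = (\<Sum>i\<le>k. of_int (digit A i) / 2 ^ a i)"
    by (intro sum.cong) (auto simp: power_diff a_mono)
  finally show ?thesis .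
qed

lemma num_Suc: "num A (Suc k) = num A k * 2 ^ (a (Suc k) - a k) + digit A (Suc k)"
proof -
  have "(2::int) ^ (a (Suc k) - a i) = 2 ^ (a k - a i) * 2 ^ (a (Suc k) - a k)" if "i \<le> k" for i
    using a_mono[OF that] a_mono[of k "Suc k"] by (simp flip: power_add)
  then have "(\<Sum>i\<le>k. digit A i * 2 ^ (a (Suc k) - a i)) = num A k * 2 ^ (a (Suc k) - a k)"
    unfolding num_def sum_distrib_right by (intro sum.cong refl) (metis atMost_iff mult.assoc)
  then show ?thesis by (simp add: num_def)
qed

lemma odd_num: "odd (num A k)"
proof (cases k)
  case 0
  then show ?thesis by (simp add: num_def digit_def)
next
  case (Suc j)
  have "a j < a (Suc j)" using a_quad[of j] by simp
  then show ?thesis by (simp add: Suc num_Suc digit_def)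
qed

text \<open>As \<open>a\<close> grows by at least 1 per step, the tail is dominated by a geometric
  series of ratio 1/2.\<close>

lemma alpha_minus_num:
  "0 < alpha A - of_int (num A k) / 2 ^ a k" "alpha A - of_int (num A k) / 2 ^ a k \<le> 8 / 2 ^ a (Suc k)"
proof -
  define g where "g i = of_int (digit A i) / (2 ^ a i :: real)" for i
  have g_pos: "0 < g i" for i by (simp add: g_def digit_def)
  have g_le: "g (j + i) \<le> 3 / 2 ^ a j * (1 / 2) ^ i" for i j
  proof -
    have "g (j + i) \<le> 3 / 2 ^ a (j + i)" unfolding g_def by (intro divide_right_mono) (auto simp: digit_def)
    also have "\<dots> \<le> 3 / 2 ^ (a j + i)" by (intro divide_left_mono power_increasing a_add) auto
    finally show ?thesis by (simp add: power_add power_divide)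
  qed
  have geo: "summable (\<lambda>i. 3 / 2 ^ a j * (1 / 2 :: real) ^ i)" for j
    by (intro summable_mult summable_geometric) auto
  have sm: "summable (\<lambda>i. g (j + i))" for j
    by (rule summable_comparison_test'[OF geo[of j], of 0]) (use g_le g_pos in \<open>auto simp: less_imp_le\<close>)
  have sm': "summable g" using sm[of 0] by simp
  have eq: "alpha A - of_int (num A k) / 2 ^ a k = (\<Sum>i. g (Suc k + i))"
    using suminf_minus_initial_segment[OF sm', of "Suc k"]
    by (simp add: num_div alpha_def lessThan_Suc_atMost add.commute flip: g_def)
  show "0 < alpha A - of_int (num A k) / 2 ^ a k"
    unfolding eq using g_pos by (intro suminf_pos sm)
  have "(\<Sum>i. g (Suc k + i)) \<le> (\<Sum>i. 3 / 2 ^ a (Suc k) * (1 / 2) ^ i)"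
    by (intro suminf_le g_le sm geo)
  also have "\<dots> = 6 / 2 ^ a (Suc k)"
    by (subst suminf_mult) (auto intro: summable_geometric simp: suminf_geometric)
  \<comment> \<open>Rounding 6 up to a power of 2 reduces later estimates to comparing
    exponents.\<close>
  also have "\<dots> \<le> 8 / 2 ^ a (Suc k)" by (intro divide_right_mono) auto
  finally show "alpha A - of_int (num A k) / 2 ^ a k \<le> 8 / 2 ^ a (Suc k)" unfolding eq .
qed

text \<open>Both partial sums have denominator \<open>2 ^ a k\<close> and lie within less than
  \<open>1 / 2 ^ a k\<close> below the same number, so their numerators differ by less than
  1.\<close>

lemma alpha_eqD_num:
  assumes "alpha A = alpha B"
  shows "num A k = num B k"
proof -
  have "8 / 2 ^ a (Suc k) < (1 / 2 ^ a k :: real)"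
  proof -
    have "(8::real) * 2 ^ a k = 2 ^ (a k + 3)" by (simp add: power_add)
    also have "\<dots> < 2 ^ a (Suc k)" using a_quad[of k] by (intro power_strict_increasing) auto
    finally show ?thesis by (simp add: field_simps)
  qed
  then have "\<bar>of_int (num A k) / 2 ^ a k - of_int (num B k) / 2 ^ a k\<bar> < (1 / 2 ^ a k :: real)"
    using alpha_minus_num[of A k] alpha_minus_num[of B k] assms by linarith
  then have "\<bar>of_int (num A k - num B k)\<bar> < (1::real)"
    by (simp add: flip: diff_divide_distrib abs_divide) (simp add: divide_less_cancel)
  then show ?thesis by linarith
qed

lemma inj_alpha: "inj alpha"
proof (rule injI)
  fix A B assume eq: "alpha A = alpha B"
  have "digit A k = digit B k" for k
  proof (cases k)
    case 0
    then show ?thesis using alpha_eqD_num[OF eq, of 0] by (simp add: num_def)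
  next
    case (Suc j)
    then show ?thesis using alpha_eqD_num[OF eq, of j] alpha_eqD_num[OF eq, of "Suc j"] by (simp add: num_Suc)
  qed
  then have "k \<in> A \<longleftrightarrow> k \<in> B" for k
    unfolding digit_def by (metis numeral_eq_one_iff semiring_norm(84))
  then show "A = B" by blast
qed

lemma power_times_alpha:
  "0 < 2 ^ a k * alpha A - of_int (num A k)" "2 ^ a k * alpha A - of_int (num A k) \<le> 8 * 2 ^ a k / 2 ^ a (Suc k)"
proof -
  have eq: "2 ^ a k * alpha A - of_int (num A k) = 2 ^ a k * (alpha A - of_int (num A k) / 2 ^ a k)"
    by (simp add: algebra_simps)
  show "0 < 2 ^ a k * alpha A - of_int (num A k)"
    unfolding eq using alpha_minus_num(1)[of A k] by simp
  have "2 ^ a k * (alpha A - of_int (num A k) / 2 ^ a k) \<le> 2 ^ a k * (8 / 2 ^ a (Suc k))"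
    by (intro mult_left_mono alpha_minus_num) auto
  then show "2 ^ a k * alpha A - of_int (num A k) \<le> 8 * 2 ^ a k / 2 ^ a (Suc k)"
    unfolding eq by (simp add: mult.commute)
qed

text \<open>A denominator \<open>q\<close> would make
  \<open>q * (2 ^ a k * alpha A - num A k)\<close> an integer, yet for suitable \<open>k\<close> it
  lies strictly between 0 and 1.\<close>

lemma alpha_irrational: "alpha A \<notin> \<rat>"
proof
  assume "alpha A \<in> \<rat>"
  then obtain p q :: int where q: "q > 0" "alpha A = of_int p / of_int q"
    by (metis Rats_cases')
  \<comment> \<open>Large enough, because \<open>q < 2 ^ q \<le> 2 ^ a k\<close>.\<close>
  define k where "k = nat q"
  define t where "t = 2 ^ a k * p - num A k * q"
  have "real_of_int t = of_int q * (2 ^ a k * alpha A - of_int (num A k))"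
    using q by (simp add: t_def algebra_simps)
  moreover have "0 < of_int q * (2 ^ a k * alpha A - of_int (num A k))"
    using power_times_alpha(1)[of k A] q(1) by (intro mult_pos_pos) auto
  moreover have "of_int q * (2 ^ a k * alpha A - of_int (num A k)) \<le> of_int q * (8 * 2 ^ a k / 2 ^ a (Suc k))"
    using q(1) by (intro mult_left_mono power_times_alpha) auto
  moreover have "of_int q * (8 * 2 ^ a k / 2 ^ a (Suc k)) < (1::real)"
  proof -
    have "real_of_int q = real k" using q(1) by (simp add: k_def)
    also have "\<dots> < 2 ^ k" by (rule of_nat_less_two_power)
    also have "\<dots> \<le> 2 ^ a k" using a_ge[of k] by (intro power_increasing) auto
    finally have "of_int q * (8 * 2 ^ a k) < (2 ^ a k * (8 * 2 ^ a k) :: real)"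
      by (intro mult_strict_right_mono) auto
    also have "\<dots> = 2 ^ (a k + a k + 3)" by (simp only: power_add) simp
    also have "\<dots> \<le> 2 ^ a (Suc k)" using a_quad[of k] by (intro power_increasing) auto
    finally show ?thesis by (simp add: field_simps)
  qed
  ultimately have "0 < t" "t < 1" by linarith+
  then show False by simp
qed

lemma liouville_alpha: "liouville (alpha A)"
  unfolding liouville_def
proof (intro conjI allI impI alpha_irrational)
  fix w :: real assume w: "w > 0"
  define S where "S = {n::nat. n \<ge> 1 \<and> dist_nearest_int (real n * alpha A) < real n powr (- w)}"
  obtain K :: nat where K: "w \<le> real K" using real_arch_simple by blast
  \<comment> \<open>The denominators of the partial sums are the witnesses; for
    \<open>k \<ge> w\<close>, \<open>a_quad\<close> gives
    \<open>a (Suc k) > (w + 1) * a k + 3\<close>.\<close>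
  have "2 ^ a k \<in> S" if k: "K \<le> k" for k
  proof -
    have "w * real (a k) \<le> real (a k) * real (a k)"
      using K k a_ge[of k] by (intro mult_right_mono) auto
    moreover have "real (a k) * real (a k) + 4 * real (a k) + 10 \<le> real (a (Suc k))"
      using of_nat_mono[OF a_quad[of k], where 'a = real] by (simp add: power2_eq_square)
    ultimately have ex: "3 + real (a k) - real (a (Suc k)) < - w * real (a k)" by simp
    have "dist_nearest_int (2 ^ a k * alpha A) \<le> \<bar>2 ^ a k * alpha A - of_int (num A k)\<bar>"
      by (rule dist_nearest_int_le)
    also have "\<dots> \<le> 8 * 2 ^ a k / 2 ^ a (Suc k)" using power_times_alpha[of k A] by simp
    also have "\<dots> = 2 powr (3 + real (a k) - real (a (Suc k)))"
      by (simp add: powr_diff powr_add powr_realpow)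
    also have "\<dots> < 2 powr (- w * real (a k))" using ex by (intro powr_less_mono) auto
    also have "\<dots> = (2 ^ a k) powr (- w)" by (simp add: powr_powr mult.commute flip: powr_realpow)
    finally show ?thesis by (simp add: S_def)
  qed
  then have sub: "(\<lambda>k. 2 ^ a k) ` {K..} \<subseteq> S" by auto
  have "strict_mono a"
    unfolding strict_mono_Suc_iff
  proof
    show "a k < a (Suc k)" for k using a_quad[of k] by simp
  qed
  then have "inj (\<lambda>k. (2::nat) ^ a k)"
    by (simp add: inj_def strict_mono_eq)
  then have "infinite ((\<lambda>k. (2::nat) ^ a k) ` {K..})"
    using infinite_Ici by (auto dest!: finite_imageD intro: inj_on_subset)
  then show "infinite S" using sub finite_subset by blast
qed

section \<open>Distances controlled by a single partial sum\<close>

text \<open>By parity \<open>d\<close> is at least \<open>1 / (2 * 2 ^ a k)\<close>, and the tail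
  moves the point by at most half of that. The 32 is 4 times the 8 of the tail bound.\<close>

lemma dist_ge_half:
  fixes A :: "nat set"
  assumes n: "32 * Suc n * 2 ^ a k \<le> 2 ^ a (Suc k)"
  defines "d \<equiv> dist_nearest_int ((2 * real n - 1) * (of_int (num A k) / (2 * 2 ^ a k)))"
  shows "0 < d" and "d / 2 \<le> dist_nearest_int (real n * alpha A - alpha A / 2)"
proof -
  define h :: real where "h = 2 ^ a k"
  define r where "r = alpha A - of_int (num A k) / h"
  define t where "t = (2 * int n - 1) * num A k"
  have h: "h > 0" by (simp add: h_def)
  have r: "0 < r" "r \<le> 8 / 2 ^ a (Suc k)" using alpha_minus_num[of A k] by (auto simp: r_def h_def)
  have "odd t" using odd_num by (simp add: t_def)
  have d_ge: "1 / (2 * h) \<le> d"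
    unfolding d_def
  proof (rule dist_nearest_int_geI)
    fix m :: int
    have "odd (t - 2 * 2 ^ a k * m)" using \<open>odd t\<close> by simp
    then have "t - 2 * 2 ^ a k * m \<noteq> 0" by (metis even_zero)
    then have "1 \<le> \<bar>t - 2 * 2 ^ a k * m\<bar>" by linarith
    then have "1 \<le> \<bar>real_of_int (t - 2 * 2 ^ a k * m)\<bar>" by linarith
    then have "1 / (2 * h) \<le> \<bar>real_of_int (t - 2 * 2 ^ a k * m)\<bar> / (2 * h)"
      using h by (intro divide_right_mono) auto
    also have "\<dots> = \<bar>real_of_int (t - 2 * 2 ^ a k * m) / (2 * h)\<bar>" using h by simp
    also have "real_of_int (t - 2 * 2 ^ a k * m) / (2 * h) = (2 * real n - 1) * (of_int (num A k) / (2 * 2 ^ a k)) - of_int m"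
      by (simp add: t_def h_def field_simps)
    finally show "1 / (2 * h) \<le> \<bar>(2 * real n - 1) * (of_int (num A k) / (2 * 2 ^ a k)) - of_int m\<bar>" .
  qed
  then show "0 < d" using h by (auto intro: less_le_trans[rotated])
  \<comment> \<open>\<open>Suc n\<close> rather than \<open>n\<close> also covers
    \<open>n = 0\<close>, where the coefficient is -1/2.\<close>
  have "\<bar>(2 * real n - 1) / 2 * r\<bar> \<le> real (Suc n) * (8 / 2 ^ a (Suc k))"
    unfolding abs_mult using r by (intro mult_mono) auto
  also have "\<dots> \<le> 1 / (4 * h)"
  proof -
    have "real (32 * Suc n * 2 ^ a k) \<le> real (2 ^ a (Suc k))" using n by (rule of_nat_mono)
    then have "32 * real (Suc n) * h \<le> 2 ^ a (Suc k)" unfolding h_def by simp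
    then show ?thesis using h by (simp add: field_simps)
  qed
  also have "\<dots> \<le> d / 2" using d_ge by simp
  finally have "\<bar>(2 * real n - 1) / 2 * r\<bar> \<le> d / 2" .
  moreover have "real n * alpha A - alpha A / 2 = (2 * real n - 1) * (of_int (num A k) / (2 * 2 ^ a k)) + (2 * real n - 1) / 2 * r"
    by (simp add: r_def h_def field_simps)
  ultimately show "d / 2 \<le> dist_nearest_int (real n * alpha A - alpha A / 2)"
    using dist_nearest_int_perturb[of "(2 * real n - 1) * (of_int (num A k) / (2 * 2 ^ a k))" "(2 * real n - 1) / 2 * r"]
    unfolding d_def[symmetric] by (elim ssubst) linarith
qed

text \<open>Below stage k, a multiple n of alpha is governed by the k-th partial sum; cf.
  dist_ge_half.\<close>
definition stage :: "nat \<Rightarrow> nat" where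
  "stage k = 2 ^ (a (Suc k) - a k - 5)"

text \<open>The 5 in \<open>stage\<close> produces the 32 of \<open>dist_ge_half\<close>; by
  \<open>a_quad\<close> the subtraction is not truncated.\<close>

lemma stage_eq: "32 * stage k * 2 ^ a k = 2 ^ a (Suc k)"
proof -
  have "5 + (a (Suc k) - a k - 5) + a k = a (Suc k)" using a_quad[of k] by simp
  then have "(2::nat) ^ a (Suc k) = 2 ^ 5 * 2 ^ (a (Suc k) - a k - 5) * 2 ^ a k"
    by (metis power_add)
  then show ?thesis by (simp add: stage_def)
qed

lemma ln_power_a: "ln (2 ^ a k) = real (a k) * ln (2::real)"
  by (simp add: ln_realpow)

text \<open>The constant is 2 (halved distances) times 4 (\<open>sum_inverse_dist_le\<close>) times
  2 (harmonic number against \<open>ln\<close>).\<close>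

lemma block_sum_le:
  assumes "s + 2 ^ a k \<le> stage k"
  shows "(\<Sum>n = s..<s + 2 ^ a k. 1 / dist_nearest_int (real n * alpha A - alpha A / 2))
           \<le> 16 * real (2 ^ a k) * ln (real (2 ^ a k))"
proof -
  define h :: nat where "h = 2 ^ a k"
  define d where "d n = dist_nearest_int ((2 * real n - 1) * (of_int (num A k) / (2 * real h)))" for n
  have h: "h \<ge> 1" by (simp add: h_def)
  have "1 / dist_nearest_int (real n * alpha A - alpha A / 2) \<le> 2 * (1 / d n)" if n: "n \<in> {s..<s + h}" for n
  proof -
    have "Suc n \<le> stage k" using n assms by (simp add: h_def)
    then have "32 * Suc n * 2 ^ a k \<le> 32 * stage k * 2 ^ a k" by simp
    then have "32 * Suc n * 2 ^ a k \<le> 2 ^ a (Suc k)" by (simp only: stage_eq)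
    from dist_ge_half[OF this, of A]
    have "0 < d n" "d n / 2 \<le> dist_nearest_int (real n * alpha A - alpha A / 2)"
      by (simp_all add: d_def h_def)
    then have "1 / dist_nearest_int (real n * alpha A - alpha A / 2) \<le> 1 / (d n / 2)"
      by (intro divide_left_mono mult_pos_pos) auto
    then show ?thesis by simp
  qed
  then have "(\<Sum>n = s..<s + h. 1 / dist_nearest_int (real n * alpha A - alpha A / 2)) \<le> 2 * (\<Sum>n = s..<s + h. 1 / d n)"
    unfolding sum_distrib_left by (intro sum_mono) auto
  also have "\<dots> \<le> 2 * (4 * real h * harm (2 * h - 1))"
  proof -
    have "coprime (num A k) (2 * int h)"
      using odd_num[of A k] by (simp add: h_def coprime_right_2_iff_odd)
    from sum_inverse_dist_le[OF h this, of s] show ?thesis by (simp add: d_def)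
  qed
  also have "harm (2 * h - 1) \<le> 2 * ln (real h)"
  proof -
    have "harm (2 * h - 1) \<le> (harm (2 * h) :: real)" by (rule harm_mono) simp
    also have "\<dots> \<le> 1 + ln (real (2 * h))" using h by (intro harm_le_1_plus_ln) simp
    also have "\<dots> = 1 + ln 2 + ln (real h)" using h by (simp add: ln_mult)
    \<comment> \<open>Here \<open>a k \<ge> 10\<close> absorbs the additive constants.\<close>
    also have "1 + ln 2 \<le> ln (real h)"
    proof -
      have "10 * ln (2::real) \<le> real (a k) * ln 2" using a_ge[of k] by (intro mult_right_mono) auto
      also have "\<dots> = ln (real h)" using ln_power_a[of k] by (simp add: h_def)
      finally show ?thesis using ln2_ge_two_thirds by linarith
    qed
    finally show ?thesis by simp
  qed
  then have "2 * (4 * real h * harm (2 * h - 1)) \<le> 2 * (4 * real h * (2 * ln (real h)))"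
    by (intro mult_left_mono) auto
  finally show ?thesis by (simp add: h_def)
qed

section \<open>Summability for \<open>\<gamma> = \<alpha> / 2\<close>, and the almost-everywhere
  statement\<close>

context
  fixes \<xi> :: "nat \<Rightarrow> real" and A :: "nat set"
  assumes xi_ge_1: "\<And>n. n \<ge> 1 \<Longrightarrow> \<xi> n \<ge> 1"
    and xi_ge: "\<And>k n. 2 ^ a k \<le> n \<Longrightarrow> 2 ^ k \<le> \<xi> n"
begin

text \<open>The radii for Borel--Cantelli. At \<open>n = 0\<close> the value is 0, because division
  by zero makes \<open>psi\<close> vanish.\<close>

definition ratio :: "nat \<Rightarrow> real" where
  "ratio n = psi \<xi> n / dist_nearest_int (real n * alpha A - alpha A / 2)"

text \<open>This range splits into whole blocks of length \<open>2 ^ a k\<close>, on which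
  \<open>\<xi>\<close> is at least \<open>2 ^ k\<close>.\<close>

lemma sum_after_power_le: "(\<Sum>n = 2 ^ a k..<stage k. ratio n) \<le> 32 / 2 ^ k"
proof -
  define h :: nat where "h = 2 ^ a k"
  define M :: nat where "M = 2 ^ (a (Suc k) - 2 * a k - 5)"
  have Mh: "stage k = M * h"
  proof -
    have "a (Suc k) - a k - 5 = (a (Suc k) - 2 * a k - 5) + a k" using a_quad[of k] by simp
    then show ?thesis by (simp add: stage_def M_def h_def flip: power_add)
  qed
  have "(2::nat) ^ 2 \<le> h" unfolding h_def using a_ge[of k] by (intro power_increasing) auto
  then have "3 \<le> h" by simp
  moreover have "(\<Sum>n = m * h..<m * h + h. 1 / dist_nearest_int (real n * alpha A - alpha A / 2)) \<le> 16 * real h * ln (real h)"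
    if "m < M" for m
  proof -
    have "m * h + h \<le> stage k"
      using mult_le_mono1[of "Suc m" M h] that unfolding Mh by (simp add: add.commute)
    then show ?thesis using block_sum_le[of "m * h" k A] by (simp add: h_def)
  qed
  ultimately have "(\<Sum>n = h..<M * h. ratio n) \<le> 2 * 16 / 2 ^ k"
    unfolding ratio_def by (intro sum_psi_blocks_le) (auto simp: h_def M_def xi_ge)
  then show ?thesis by (simp add: Mh h_def)
qed

text \<open>Here the \<open>k\<close>-th partial sum no longer controls the distances, but the range
  lies in one block of level \<open>Suc k\<close>. Bounding \<open>psi\<close> by its size at
  \<open>stage k\<close> loses a factor \<open>32 * 2 ^ a k\<close>, which \<open>a_exp\<close>
  recovers.\<close>

lemma sum_before_power_le: "(\<Sum>n = stage k..<2 ^ a (Suc k). ratio n) \<le> 4096 / 2 ^ k"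
proof -
  define h :: nat where "h = 2 ^ a (Suc k)"
  define l where "l = ln (real h)"
  define N where "N = stage k"
  \<comment> \<open>The trailing 1 is the trivial lower bound for \<open>\<xi>\<close>; the decay in
    \<open>k\<close> comes from \<open>a (Suc k)\<close>.\<close>
  define B where "B = 1 / (real N * (ln (real N))\<^sup>2 * 1)"
  have l_eq: "l = real (a (Suc k)) * ln 2" unfolding l_def h_def by (simp add: ln_realpow)
  have l_pos: "0 < l" unfolding l_eq using a_ge[of "Suc k"] by simp
  \<comment> \<open>By \<open>a_quad\<close>, \<open>a k + 5\<close> is at most half of
    \<open>a (Suc k)\<close>.\<close>
  have lnN: "l / 2 \<le> ln (real N)"
  proof -
    have "real (a (Suc k)) / 2 * ln 2 \<le> real (a (Suc k) - a k - 5) * ln 2"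
      using a_quad[of k] by (intro mult_right_mono) auto
    then show ?thesis by (simp add: l_eq N_def stage_def ln_realpow)
  qed
  have "2 ^ 1 \<le> N" unfolding N_def stage_def using a_quad[of k] by (intro power_increasing) auto
  then have N: "2 \<le> N" by simp
  have "B \<ge> 0" by (simp add: B_def)
  have ratio_le: "ratio n \<le> B * (1 / dist_nearest_int (real n * alpha A - alpha A / 2))" if "N \<le> n" for n
  proof -
    have "psi \<xi> n \<le> B" unfolding B_def using N that xi_ge_1 by (intro psi_le) auto
    then show ?thesis by (simp add: ratio_def divide_right_mono)
  qed
  have "(\<Sum>n = N..<h. ratio n) \<le> B * (\<Sum>n = N..<h. 1 / dist_nearest_int (real n * alpha A - alpha A / 2))"
    unfolding sum_distrib_left using ratio_le by (intro sum_mono) auto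
  also have "\<dots> \<le> B * (\<Sum>n = 0..<0 + h. 1 / dist_nearest_int (real n * alpha A - alpha A / 2))"
    using \<open>B \<ge> 0\<close> by (intro mult_left_mono sum_mono2) auto
  also have "\<dots> \<le> B * (16 * real h * l)"
  proof (rule mult_left_mono[OF _ \<open>B \<ge> 0\<close>])
    have "0 + 2 ^ a (Suc k) \<le> stage (Suc k)"
      unfolding stage_def using a_quad[of "Suc k"] by (simp; intro power_increasing; simp)
    from block_sum_le[OF this, of A]
    show "(\<Sum>n = 0..<0 + h. 1 / dist_nearest_int (real n * alpha A - alpha A / 2)) \<le> 16 * real h * l"
      by (simp add: h_def l_def)
  qed
  also have "\<dots> \<le> 1 / (real N * (l / 2)\<^sup>2) * (16 * real h * l)"
  proof (rule mult_right_mono)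
    have "(l / 2)\<^sup>2 \<le> (ln (real N))\<^sup>2" using lnN l_pos by (intro power_mono) auto
    moreover have "0 < (l / 2)\<^sup>2" using l_pos by simp
    ultimately show "B \<le> 1 / (real N * (l / 2)\<^sup>2)"
      unfolding B_def using N by (intro divide_left_mono) (auto intro!: mult_left_mono mult_pos_pos)
  qed (use l_pos in simp)
  also have "real h = 32 * real N * 2 ^ a k"
    using arg_cong[OF stage_eq[of k], of real] by (simp add: h_def N_def)
  also have "1 / (real N * (l / 2)\<^sup>2) * (16 * (32 * real N * 2 ^ a k) * l) = 2048 * 2 ^ a k / l"
    using N l_pos by (simp add: field_simps power2_eq_square)
  also have "\<dots> \<le> 2048 * 2 ^ a k / (4 ^ a k / 2)"
  proof (rule divide_left_mono)
    have "real (4 ^ a k) \<le> real (a (Suc k))" using a_exp[of k] by (rule of_nat_mono)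
    then have "4 ^ a k * (1 / 2) \<le> real (a (Suc k)) * ln (2::real)"
      using ln2_ge_two_thirds by (intro mult_mono) auto
    then show "4 ^ a k / 2 \<le> l" by (simp add: l_eq)
  qed (use l_pos in auto)
  also have "\<dots> = 4096 / 2 ^ a k"
  proof -
    have "(4::real) ^ a k = 2 ^ a k * 2 ^ a k" by (simp flip: power_mult_distrib)
    then show ?thesis by simp
  qed
  also have "\<dots> \<le> 4096 / 2 ^ k"
    using a_ge[of k] by (intro divide_left_mono power_increasing) auto
  finally show ?thesis by (simp add: N_def h_def)
qed

lemma summable_ratio: "summable ratio"
proof (rule summableI_nonneg_bounded)
  show nonneg: "0 \<le> ratio n" for n
    unfolding ratio_def by (intro divide_nonneg_nonneg psi_nonneg xi_ge_1) auto
  define S where "S = sum ratio {..<stage 0}"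
  have step: "sum ratio {..<stage (Suc k)} \<le> sum ratio {..<stage k} + 5000 / 2 ^ k" for k
  proof -
    have le1: "stage k \<le> 2 ^ a (Suc k)"
      unfolding stage_def by (intro power_increasing) auto
    have le2: "2 ^ a (Suc k) \<le> stage (Suc k)"
      unfolding stage_def using a_quad[of "Suc k"] by (intro power_increasing) auto
    have "sum ratio {..<stage (Suc k)} = sum ratio {..<stage k} + sum ratio {stage k..<2 ^ a (Suc k)}
        + sum ratio {2 ^ a (Suc k)..<stage (Suc k)}"
      unfolding lessThan_atLeast0 using le1 le2
      by (simp add: sum.atLeastLessThan_concat)
    also have "\<dots> \<le> sum ratio {..<stage k} + 4096 / 2 ^ k + 32 / 2 ^ Suc k"
      by (intro add_mono sum_before_power_le sum_after_power_le) simp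
    also have "\<dots> = sum ratio {..<stage k} + 4112 / 2 ^ k" by (simp add: field_simps)
    also have "\<dots> \<le> sum ratio {..<stage k} + 5000 / 2 ^ k" by (simp add: divide_right_mono)
    finally show ?thesis .
  qed
  \<comment> \<open>Subtracting the geometric remainder makes the bound inductive: it drops by
    exactly \<open>5000 / 2 ^ k\<close> per step.\<close>
  have bound: "sum ratio {..<stage k} \<le> S + 10000 - 10000 / 2 ^ k" for k
  proof (induction k)
    case (Suc k)
    have "10000 / 2 ^ k = 10000 / 2 ^ Suc k + (5000 / 2 ^ k :: real)" by simp
    then show ?case using step[of k] Suc.IH by linarith
  qed (simp add: S_def)
  show "sum ratio {..<n} \<le> S + 10000" for n
  proof -
    have "n < 2 ^ n" by (rule less_exp)
    also have "\<dots> \<le> stage n"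
      unfolding stage_def using a_quad[of n] a_ge[of n] by (intro power_increasing) auto
    finally have "sum ratio {..<n} \<le> sum ratio {..<stage n}"
      using nonneg by (intro sum_mono2) auto
    also have "\<dots> \<le> S + 10000" using bound[of n] by (smt (verit) divide_nonneg_nonneg zero_le_power)
    finally show ?thesis .
  qed
qed

lemma AE_finite_product_less_psi:
  "AE y in lebesgue. finite {n::nat. n \<ge> 1 \<and>
     dist_nearest_int (real n * alpha A - alpha A / 2) * dist_nearest_int (real n * y - \<gamma>) < psi \<xi> n}"
proof -
  \<comment> \<open>Otherwise \<open>alpha A = 2 * m / (2 * n - 1)\<close> would be
    rational.\<close>
  have "0 < dist_nearest_int (real n * alpha A - alpha A / 2)" for n
    unfolding dist_nearest_int_pos_iff
  proof
    assume "real n * alpha A - alpha A / 2 \<in> \<int>"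
    then obtain m :: int where m: "real n * alpha A - alpha A / 2 = of_int m" by (auto elim: Ints_cases)
    have "2 * int n - 1 \<noteq> 0" by presburger
    then have "real_of_int (2 * int n - 1) \<noteq> 0" unfolding of_int_eq_0_iff .
    then have ne: "2 * real n - 1 \<noteq> 0"
      by (simp only: of_int_diff of_int_mult of_int_numeral of_int_of_nat_eq of_int_1 not_False_eq_True)
    have "alpha A * (2 * real n - 1) = 2 * of_int m" using m by (simp add: algebra_simps)
    then have "alpha A = 2 * of_int m / (2 * real n - 1)" using ne by (simp add: eq_divide_eq)
    also have "\<dots> \<in> \<rat>" by auto
    finally show False using alpha_irrational by blast
  qed
  then have "{n. n \<ge> 1 \<and> dist_nearest_int (real n * alpha A - alpha A / 2) * dist_nearest_int (real n * y - \<gamma>) < psi \<xi> n}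
      = {n. n \<ge> 1 \<and> dist_nearest_int (real n * y - \<gamma>) < ratio n}" for y
    by (simp add: ratio_def pos_less_divide_eq mult.commute)
  moreover have "0 \<le> ratio n" for n
    unfolding ratio_def by (intro divide_nonneg_nonneg psi_nonneg xi_ge_1) auto
  ultimately show ?thesis
    using AE_finite_dist_nearest_int_less[OF summable_ratio, of \<gamma>] by simp
qed

end

end

section \<open>Choice of the exponents, and the cardinality count\<close>

text \<open>Each condition only asks \<open>a k\<close> to be large in terms of \<open>k\<close> and
  its predecessor: a non-decreasing unbounded \<open>\<xi>\<close> eventually stays above
  \<open>2 ^ k\<close>. Dependent choice then applies.\<close>

lemma sparse_exponents_exist:
  fixes \<xi> :: "nat \<Rightarrow> real"
  assumes mono: "mono_on {1..} \<xi>" and unbdd: "\<not> bdd_above (\<xi> ` {1..})"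
  obtains a where "sparse_exponents a" "\<And>k n. 2 ^ a k \<le> n \<Longrightarrow> 2 ^ k \<le> \<xi> n"
proof -
  have large: "\<exists>N. \<forall>n\<ge>N. x \<le> \<xi> n" for x
  proof -
    obtain N where "N \<ge> 1" "x < \<xi> N"
      using unbdd by (auto simp: bdd_above_def not_le)
    then have "\<forall>n\<ge>N. x \<le> \<xi> n"
      using monotone_onD[OF mono, of N] by (fastforce intro: order_trans[OF less_imp_le])
    then show ?thesis by blast
  qed
  define P where "P k b \<longleftrightarrow> 10 \<le> b \<and> (\<forall>n\<ge>2 ^ b. 2 ^ k \<le> \<xi> n)" for k b
  have ex: "\<exists>b\<ge>c. P k b" for c k
  proof -
    obtain N where N: "\<And>n. n \<ge> N \<Longrightarrow> 2 ^ k \<le> \<xi> n" using large by blast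
    define b where "b = c + N + 10"
    have "N \<le> b" by (simp add: b_def)
    also have "b < 2 ^ b" by (rule less_exp)
    finally have "N \<le> 2 ^ b" by simp
    then have "P k b" using N by (simp add: P_def b_def)
    moreover have "c \<le> b" by (simp add: b_def)
    ultimately show ?thesis by blast
  qed
  have "\<exists>a. \<forall>k. P k (a k) \<and> max (4 ^ a k) ((a k)\<^sup>2 + 4 * a k + 10) \<le> a (Suc k)"
  proof (rule dependent_nat_choice)
    show "\<exists>b. P 0 b" using ex by blast
    show "\<exists>c. P (Suc k) c \<and> max (4 ^ b) (b\<^sup>2 + 4 * b + 10) \<le> c" for b k
      using ex by blast
  qed
  then obtain a where a: "\<And>k. P k (a k)" "\<And>k. max (4 ^ a k) ((a k)\<^sup>2 + 4 * a k + 10) \<le> a (Suc k)"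
    by blast
  have "sparse_exponents a"
    by unfold_locales (use a in \<open>auto simp: P_def\<close>)
  then show ?thesis using that a(1) by (simp add: P_def)
qed

theorem theorem1p14:
  fixes \<xi> :: "nat \<Rightarrow> real"
  assumes "\<And>n. n \<ge> 1 \<Longrightarrow> \<xi> n \<ge> 1"
    and "mono_on {1..} \<xi>"
    and "\<not> bdd_above (\<xi> ` {1..})"
  shows "{(\<alpha>\<^sub>1, \<gamma>\<^sub>1). liouville \<alpha>\<^sub>1 \<and>
           (\<forall>\<gamma>\<^sub>2::real. AE \<alpha>\<^sub>2 in lebesgue.
              finite {n::nat. n \<ge> 1 \<and>
                dist_nearest_int (real n * \<alpha>\<^sub>1 - \<gamma>\<^sub>1) * dist_nearest_int (real n * \<alpha>\<^sub>2 - \<gamma>\<^sub>2) < psi \<xi> n})}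
         \<approx> (UNIV :: real set)"
    (is "?S \<approx> _")
proof (rule lepoll_antisym)
  \<comment> \<open>Upper bound: the plane has the cardinality of the line.\<close>
  have "(UNIV :: real set) \<times> (UNIV :: real set) \<approx> (UNIV :: real set)"
    unfolding eqpoll_iff_card_of_ordIso by (rule card_of_Times_same_infinite) (simp add: infinite_UNIV_char_0)
  moreover have "?S \<subseteq> UNIV \<times> UNIV" by simp
  ultimately show "?S \<lesssim> (UNIV :: real set)"
    by (blast intro: lepoll_trans2 subset_imp_lepoll)
  obtain a where a: "sparse_exponents a" "\<And>k n. 2 ^ a k \<le> n \<Longrightarrow> 2 ^ k \<le> \<xi> n"
    using sparse_exponents_exist[OF assms(2,3)] by metis
  interpret sparse_exponents a by (rule a)
  \<comment> \<open>Lower bound: each set of naturals contributes its own pair.\<close>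
  have "(alpha A, alpha A / 2) \<in> ?S" for A
    using liouville_alpha AE_finite_product_less_psi[OF assms(1) a(2)] by auto
  then have "range (\<lambda>A. (alpha A, alpha A / 2)) \<subseteq> ?S" by blast
  moreover have "inj (\<lambda>A. (alpha A, alpha A / 2))"
    using inj_alpha by (auto simp: inj_def)
  ultimately have "(UNIV :: nat set set) \<lesssim> ?S"
    unfolding lepoll_def by blast
  then show "(UNIV :: real set) \<lesssim> ?S"
    by (rule lepoll_trans1[OF eqpoll_sym[OF nat_sets_eqpoll_reals]])
qed

end
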